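(* Let $N=\{1,\dots,n\}$ be a set of agents who all have the same nonnegative additive valuation $v$, and let indivisible goods $g_1,g_2,\dots$ arrive one at a time, in any order. Then the least-valued-bundle rule maintains EF1 after every arriving good: if, starting from empty bundles, each arriving good $g_t$ is assigned to some agent $r\in\operatorname*{arg\,min}_{i\in N}v(A_i^{t-1})$, then the accumulated allocation $A^t$ is EF1 for every $t$.
   Context: $A^t=(A^t_1,\dots,A^t_n)$ denotes the accumulated allocation after the first $t$ arrivals ($A^0_i=\emptyset$ for all $i$); assigning $g_t$ to agent $r$ means $A^t_r=A^{t-1}_r\cup\{g_t\}$ and $A^t_i=A^{t-1}_i$ for $i\ne r$. Ties in the arg min may be broken arbitrarily. Nonnegative additive means $v(S)=\sum_{g\in S}v(g)$ with $v(g)\ge 0$. The allocation $A^t$ is EF1 (envy-free up to one good) if for every pair $i,j\in N$ with $A^t_j\neq\emptyset$ there exists $g\in A^t_j$ such that $v(A^t_i)\ge v(A^t_j\setminus\{g\})$. *)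

theory Defs
  imports Complex_Main "HOL-Library.Extended_Nat"
begin

(* The value of a single good x is v {x}.  Only finite bundles are constrained:
   a sum over an infinite set is 0 by convention. *)
definition nonneg_additive :: "'g set \<Rightarrow> ('g set \<Rightarrow> real) \<Rightarrow> bool" where
  "nonneg_additive M v \<longleftrightarrow>
     (\<forall>x\<in>M. 0 \<le> v {x}) \<and>
     (\<forall>S. finite S \<and> S \<subseteq> M \<longrightarrow> v S = (\<Sum>x\<in>S. v {x}))"

definition EF1 :: "'a set \<Rightarrow> ('g set \<Rightarrow> real) \<Rightarrow> ('a \<Rightarrow> 'g set) \<Rightarrow> bool" where
  "EF1 N v B \<longleftrightarrow>
     (\<forall>i\<in>N. \<forall>j\<in>N. B j \<noteq> {} \<longrightarrow> (\<exists>x\<in>B j. v (B i) \<ge> v (B j - {x})))"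

definition assigns :: "'a set \<Rightarrow> 'g \<Rightarrow> 'a \<Rightarrow> ('a \<Rightarrow> 'g set) \<Rightarrow> ('a \<Rightarrow> 'g set) \<Rightarrow> bool" where
  "assigns N x r B B' \<longleftrightarrow> B' r = B r \<union> {x} \<and> (\<forall>i\<in>N. i \<noteq> r \<longrightarrow> B' i = B i)"

(* Arrivals are numbered from 1; the number T of arrivals may be infinite. *)
definition arrival_times :: "enat \<Rightarrow> nat set" where
  "arrival_times T = {t. 1 \<le> t \<and> enat t \<le> T}"

definition least_valued_bundle_run ::
  "'a set \<Rightarrow> ('g set \<Rightarrow> real) \<Rightarrow> enat \<Rightarrow> (nat \<Rightarrow> 'g) \<Rightarrow> (nat \<Rightarrow> 'a \<Rightarrow> 'g set) \<Rightarrow> bool" where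
  "least_valued_bundle_run N v T g A \<longleftrightarrow>
     (\<forall>i\<in>N. A 0 i = {}) \<and>
     (\<forall>t\<in>arrival_times T.
        \<exists>r. is_arg_min (\<lambda>i. v (A (t - 1) i)) (\<lambda>i. i \<in> N) r \<and>
            assigns N (g t) r (A (t - 1)) (A t))"

end

theory Submission
  imports Defs
begin

text \<open>Induction on the arrivals. A step changes only the bundle of the receiver
  \<open>r\<close>, and by nonnegativity no bundle loses value
  (\<open>nonneg_additive_mono\<close>). Envy towards an agent other than \<open>r\<close> is
  therefore still removed by the good that removed it before. Envy towards \<open>r\<close> vanishes
  once the new good is taken away, since the old bundle of \<open>r\<close> was worth no more than
  any other. \<open>EF1_assigns_arg_min\<close> combines the two cases.\<close>

lemma nonneg_additive_mono:
  assumes "nonneg_additive M v" "finite S'" "S' \<subseteq> M" "S \<subseteq> S'"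
  shows "v S \<le> v S'"
proof -
  have "(\<Sum>x\<in>S. v {x}) \<le> (\<Sum>x\<in>S'. v {x})"
    using assms by (intro sum_mono2) (auto simp: nonneg_additive_def)
  moreover have "finite S" "S \<subseteq> M"
    using assms finite_subset by auto
  ultimately show ?thesis
    using assms by (simp add: nonneg_additive_def)
qed

text \<open>Towards the receiver \<open>r\<close>, the removed good is the new one: what remains is the old bundle
  of \<open>r\<close>, which was a least valued one.\<close>

lemma EF1_assigns_arg_min:
  assumes "EF1 N v B"
    and min: "is_arg_min (\<lambda>i. v (B i)) (\<lambda>i. i \<in> N) r"
    and asg: "assigns N x r B B'"
    and "x \<notin> B r"
    and mono: "v (B r) \<le> v (B' r)"
  shows "EF1 N v B'"
  unfolding EF1_def
proof (intro ballI impI)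
  fix i j assume ij: "i \<in> N" "j \<in> N" "B' j \<noteq> {}"
  have B'r: "B' r = insert x (B r)" and B'i: "\<And>k. k \<in> N \<Longrightarrow> k \<noteq> r \<Longrightarrow> B' k = B k"
    using asg by (auto simp: assigns_def)
  \<comment> \<open>Both cases need this for the envious agent \<open>i\<close>, who may be
    \<open>r\<close> itself.\<close>
  have grow: "v (B i) \<le> v (B' i)"
    using mono B'i ij by (cases "i = r") auto
  show "\<exists>y\<in>B' j. v (B' i) \<ge> v (B' j - {y})"
  proof (cases "j = r")
    case True
    have "v (B r) \<le> v (B i)"
      using min ij by (auto simp: is_arg_min_linorder)
    moreover have "B' r - {x} = B r"
      using B'r \<open>x \<notin> B r\<close> by auto
    ultimately show ?thesis
      using True B'r grow by auto
  next
    case False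
    then have "B' j = B j" using B'i ij by simp
    moreover obtain y where "y \<in> B j" "v (B i) \<ge> v (B j - {y})"
      using \<open>EF1 N v B\<close> ij \<open>B' j = B j\<close> unfolding EF1_def by metis
    ultimately show ?thesis
      using grow by (auto intro: order_trans)
  qed
qed

theorem theorem5:
  fixes n :: nat and T :: enat
    and g :: "nat \<Rightarrow> 'g"
    and v :: "'g set \<Rightarrow> real"
    and A :: "nat \<Rightarrow> nat \<Rightarrow> 'g set"
  assumes distinct_goods: "inj_on g (arrival_times T)"
    and valuation: "nonneg_additive (g ` arrival_times T) v"
    and run: "least_valued_bundle_run {1..n} v T g A"
  shows "\<forall>t. enat t \<le> T \<longrightarrow> EF1 {1..n} v (A t)"
proof -
  \<comment> \<open>The invariant also confines bundles to goods that have already arrived: this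
    makes the next good new to its receiver and keeps bundles finite.\<close>
  have "(\<forall>i\<in>{1..n}. A t i \<subseteq> g ` {1..t}) \<and> EF1 {1..n} v (A t)" if "enat t \<le> T" for t
    using that
  proof (induction t)
    case 0
    have "\<forall>i\<in>{1..n}. A 0 i = {}"
      using run by (simp add: least_valued_bundle_run_def)
    then show ?case by (simp add: EF1_def)
  next
    case (Suc t)
    have "enat t \<le> T"
      using Suc.prems by (meson enat_ord_simps(1) le_Suc_eq order_trans order_refl)
    then have sub: "\<And>i. i \<in> {1..n} \<Longrightarrow> A t i \<subseteq> g ` {1..t}" and EF1: "EF1 {1..n} v (A t)"
      using Suc.IH by auto
    have times: "{1..Suc t} \<subseteq> arrival_times T"
      using Suc.prems by (auto simp: arrival_times_def intro: order_trans[of _ "enat (Suc t)"])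
    then have "Suc t \<in> arrival_times T" by auto
    then obtain r where min: "is_arg_min (\<lambda>i. v (A t i)) (\<lambda>i. i \<in> {1..n}) r"
      and asg: "assigns {1..n} (g (Suc t)) r (A t) (A (Suc t))"
      using run by (force simp: least_valued_bundle_run_def)
    have r: "r \<in> {1..n}" using min by (simp add: is_arg_min_def)
    have sub': "A (Suc t) i \<subseteq> g ` {1..Suc t}" if "i \<in> {1..n}" for i
    proof (cases "i = r")
      case True
      then show ?thesis using asg sub[OF r] by (auto simp: assigns_def)
    next
      case False
      then show ?thesis using asg sub[OF that] that by (force simp: assigns_def)
    qed
    \<comment> \<open>Distinctness of the goods enters here: if \<open>r\<close> already held the
      arriving good, removing it would leave less than the old bundle.\<close>
    have "g (Suc t) \<notin> g ` {1..t}"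
      using inj_on_subset[OF distinct_goods times] by (fastforce simp: inj_on_def)
    then have new: "g (Suc t) \<notin> A t r" using sub[OF r] by auto
    \<comment> \<open>Additivity speaks only of finite bundles of arriving goods, so monotonicity of
      \<open>v\<close> requires both properties.\<close>
    have "finite (A (Suc t) r)"
      using sub'[OF r] by (rule finite_subset) simp
    moreover have "A (Suc t) r \<subseteq> g ` arrival_times T"
      using sub'[OF r] times by blast
    moreover have "A t r \<subseteq> A (Suc t) r"
      using asg by (auto simp: assigns_def)
    ultimately have "v (A t r) \<le> v (A (Suc t) r)"
      by (rule nonneg_additive_mono[OF valuation])
    with EF1 min asg new have "EF1 {1..n} v (A (Suc t))"
      by (rule EF1_assigns_arg_min)
    with sub' show ?case by blast
  qed
  then show ?thesis by blast
qed

end
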